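(* For parameters $f\in(0,1)$, $s^+>0$, $s^-<0$, $\lambda_1,\lambda_2\in\mathbb{R}$, let $\pi_{f,s^+,s^-,\lambda_1,\lambda_2}$ denote the Chen 4-slope function defined in the context, and let (H) denote the system of conditions $$f\ge\tfrac12,\quad s^+\ge\tfrac1f,\quad s^-\le\tfrac{1}{f-1},\quad 0\le\lambda_1<\min\Big\{\tfrac12,\ \tfrac{s^+-s^-}{s^+(1-s^-f)}\Big\},$$ $$f-\tfrac{1}{s^+}<\lambda_2<\min\Big\{\tfrac12,\ \tfrac{s^+-s^-}{s^-(s^+(f-1)-1)}\Big\}.$$ Then (H) is neither sufficient nor necessary for $\pi_{f,s^+,s^-,\lambda_1,\lambda_2}$ to be an extreme function for $R_f(\mathbb{R},\mathbb{Z})$. More precisely: (1) The parameters $f=\frac{7}{10}$, $s^+=2$, $s^-=-4$, $\lambda_1=\frac{1}{100}$, $\lambda_2=\frac{49}{100}$ satisfy (H), but the corresponding function is not subadditive, and thus is not an extreme function for $R_f(\mathbb{R},\mathbb{Z})$. (2) The parameters $f=\frac{7}{10}$, $s^+=2$, $s^-=-4$, $\lambda_1=\frac{1}{10}$, $\lambda_2=\frac{1}{10}$ do not satisfy (H), but the corresponding function is an extreme function for $R_f(\mathbb{R},\mathbb{Z})$.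
   Context: Fix $f\in\mathbb{R}\setminus\mathbb{Z}$. The (single-row) infinite group problem considers all functions $y\colon\mathbb{R}\to\mathbb{Z}_+$ of finite support (where $\mathbb{Z}_+$ denotes the nonnegative integers) satisfying $\sum_{r\in\mathbb{R}} r\,y(r)\equiv f \pmod 1$, i.e., $\sum_r r\,y(r) - f\in\mathbb{Z}$. $R_f(\mathbb{R},\mathbb{Z})$ denotes the convex hull of the set of all such functions $y$. A valid function for $R_f(\mathbb{R},\mathbb{Z})$ is a nonnegative function $\pi\colon\mathbb{R}\to\mathbb{R}$ such that $\sum_{r\in\mathbb{R}}\pi(r)\,y(r)\ge 1$ for every $y\in R_f(\mathbb{R},\mathbb{Z})$. A valid function $\pi$ is extreme if it is not a proper convex combination of other valid functions; that is, whenever $\pi=\tfrac12(\pi_1+\pi_2)$ with $\pi_1,\pi_2$ valid functions, then $\pi_1=\pi_2=\pi$. A function $\pi$ is subadditive if $\pi(x+y)\le\pi(x)+\pi(y)$ for all $x,y\in\mathbb{R}$. A function on $\mathbb{R}/\mathbb{Z}$ is identified with a $1$-periodic function on $\mathbb{R}$. Chen 4-slope function: given $f\in(0,1)$, $s^+>0$, $s^-<0$ and $\lambda_1,\lambda_2\in\mathbb{R}$, put $$a'=\frac{\lambda_1(1-s^-f)}{2(s^+-s^-)},\quad a=\frac{\lambda_1 f}{2},\quad c=1-\frac{\lambda_2(1-f)}{2},\quad c'=1-\frac{\lambda_2\,(1+s^+(1-f))}{2(s^+-s^-)},$$ $$b=f-a,\quad b'=f-a',\quad d=1+f-c,\quad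 d'=1+f-c'.$$ The function $\pi=\pi_{f,s^+,s^-,\lambda_1,\lambda_2}\colon\mathbb{R}/\mathbb{Z}\to\mathbb{R}$ is the continuous piecewise linear function with $\pi(0)=\pi(1)=0$ that has $10$ pieces on $[0,1]$ with breakpoints, in order, $0,a',a,b,b',f,d',d,c,c',1$, and slopes on the successive pieces equal to $$s^+,\ s^-,\ \tfrac1f,\ s^-,\ s^+,\ s^-,\ s^+,\ \tfrac{1}{f-1},\ s^+,\ s^-.$$ *)

theory Defs
  imports "HOL-Analysis.Analysis" "HOL-Library.Function_Algebras"
begin

(* The pointwise real vector space structure on function spaces, so that the library's
   convex hull applies to sets of functions. *)
instantiation "fun" :: (type, real_vector) real_vector
begin

definition scaleR_fun :: "real \<Rightarrow> ('a \<Rightarrow> 'b) \<Rightarrow> 'a \<Rightarrow> 'b"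
  where "scaleR_fun c g = (\<lambda>x. c *\<^sub>R g x)"

instance
  by standard (auto simp: scaleR_fun_def plus_fun_def fun_eq_iff algebra_simps)

end

(* The values are nonnegative integers but are regarded as reals, because convex combinations
   of these functions are formed. *)
definition group_solutions :: "real \<Rightarrow> (real \<Rightarrow> real) set"
  where "group_solutions f =
    {y. finite {r. y r \<noteq> 0} \<and> (\<forall>r. y r \<in> \<nat>) \<and> (\<Sum>r | y r \<noteq> 0. r * y r) - f \<in> \<int>}"

definition infinite_group_polyhedron :: "real \<Rightarrow> (real \<Rightarrow> real) set"
  where "infinite_group_polyhedron f = convex hull (group_solutions f)"

definition valid_function :: "real \<Rightarrow> (real \<Rightarrow> real) \<Rightarrow> bool"
  where "valid_function f \<pi> \<longleftrightarrow>
    (\<forall>r. 0 \<le> \<pi> r) \<and>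
    (\<forall>y\<in>infinite_group_polyhedron f. (\<Sum>r | y r \<noteq> 0. \<pi> r * y r) \<ge> 1)"

definition extreme_function :: "real \<Rightarrow> (real \<Rightarrow> real) \<Rightarrow> bool"
  where "extreme_function f \<pi> \<longleftrightarrow>
    valid_function f \<pi> \<and>
    (\<forall>\<pi>1 \<pi>2. valid_function f \<pi>1 \<and> valid_function f \<pi>2 \<and>
        (\<forall>x. \<pi> x = 1/2 * (\<pi>1 x + \<pi>2 x)) \<longrightarrow> \<pi>1 = \<pi> \<and> \<pi>2 = \<pi>)"

definition subadditive_function :: "(real \<Rightarrow> real) \<Rightarrow> bool"
  where "subadditive_function \<pi> \<longleftrightarrow> (\<forall>x y. \<pi> (x + y) \<le> \<pi> x + \<pi> y)"

definition chen_breakpoints :: "real \<Rightarrow> real \<Rightarrow> real \<Rightarrow> real \<Rightarrow> real \<Rightarrow> real list"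
  where "chen_breakpoints f sp sm l1 l2 =
    (let a' = l1 * (1 - sm * f) / (2 * (sp - sm));
         a = l1 * f / 2;
         c = 1 - l2 * (1 - f) / 2;
         c' = 1 - l2 * (1 + sp * (1 - f)) / (2 * (sp - sm));
         b = f - a;
         b' = f - a';
         d = 1 + f - c;
         d' = 1 + f - c'
     in [0, a', a, b, b', f, d', d, c, c', 1])"

definition chen_slopes :: "real \<Rightarrow> real \<Rightarrow> real \<Rightarrow> real list"
  where "chen_slopes f sp sm = [sp, sm, 1 / f, sm, sp, sm, sp, 1 / (f - 1), sp, sm]"

(* Functions on the reals modulo 1 are 1-periodic functions on the reals. With t = frac x and
   breakpoints p ! 0 <= ... <= p ! 10, the difference min t (p ! Suc i) - min t (p ! i) is the
   length of the part of the i-th piece that lies in [0, t], so the sum is the integral over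
   [0, t] of the step function with the prescribed slopes. *)
definition chen_function :: "real \<Rightarrow> real \<Rightarrow> real \<Rightarrow> real \<Rightarrow> real \<Rightarrow> real \<Rightarrow> real"
  where "chen_function f sp sm l1 l2 x =
    (\<Sum>i<10. chen_slopes f sp sm ! i *
       (min (frac x) (chen_breakpoints f sp sm l1 l2 ! Suc i) -
        min (frac x) (chen_breakpoints f sp sm l1 l2 ! i)))"

definition chen_conditions :: "real \<Rightarrow> real \<Rightarrow> real \<Rightarrow> real \<Rightarrow> real \<Rightarrow> bool"
  where "chen_conditions f sp sm l1 l2 \<longleftrightarrow>
    f \<ge> 1/2 \<and> sp \<ge> 1 / f \<and> sm \<le> 1 / (f - 1) \<and>
    0 \<le> l1 \<and> l1 < min (1/2) ((sp - sm) / (sp * (1 - sm * f))) \<and>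
    f - 1 / sp < l2 \<and> l2 < min (1/2) ((sp - sm) / (sm * (sp * (f - 1) - 1)))"


lemma chen_function_periodic: "chen_function f sp sm l1 l2 (x + 1) = chen_function f sp sm l1 l2 x"
  by (simp add: chen_function_def frac_1_eq)

lemma chen_function_0:
  assumes "sorted (chen_breakpoints f sp sm l1 l2)"
  shows "chen_function f sp sm l1 l2 0 = 0"
proof -
  let ?p = "chen_breakpoints f sp sm l1 l2"
  have "0 \<le> ?p ! j" if "j \<le> 10" for j
    using sorted_nth_mono[OF assms, of 0 j] that by (simp add: chen_breakpoints_def Let_def)
  then show ?thesis by (simp add: chen_function_def)
qed

(* frac sends 1 to 0, so the affine formula on the last piece includes the fact that the
   increments over the ten pieces add up to 0. *)
lemma chen_function_slope:
  assumes "0 < f" "f < 1" "sp > 0" "sm < 0"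
    and sorted: "sorted (chen_breakpoints f sp sm l1 l2)"
    and i: "i < 10"
    and x: "x \<in> {chen_breakpoints f sp sm l1 l2 ! i .. chen_breakpoints f sp sm l1 l2 ! Suc i}"
    and y: "y \<in> {chen_breakpoints f sp sm l1 l2 ! i .. chen_breakpoints f sp sm l1 l2 ! Suc i}"
  shows "chen_function f sp sm l1 l2 y - chen_function f sp sm l1 l2 x =
    chen_slopes f sp sm ! i * (y - x)"
proof -
  define p where "p = chen_breakpoints f sp sm l1 l2"
  define s where "s = chen_slopes f sp sm"
  define F where "F t = (\<Sum>j<10. s ! j * (min t (p ! Suc j) - min t (p ! j)))" for t
  have len: "length p = 11" by (simp add: p_def chen_breakpoints_def Let_def)
  have mono: "p ! j \<le> p ! k" if "j \<le> k" "k \<le> 10" for j k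
    using sorted_nth_mono[OF sorted[folded p_def] that(1)] that(2) len by simp
  have p0: "p ! 0 = 0" and p10: "p ! 10 = 1"
    by (simp_all add: p_def chen_breakpoints_def Let_def)
  have "F 1 = (\<Sum>j<10. s ! j * (p ! Suc j - p ! j))"
    unfolding F_def
  proof (rule sum.cong[OF refl])
    fix j :: nat assume "j \<in> {..<10}"
    then have "p ! Suc j \<le> 1" "p ! j \<le> 1" using mono[of "Suc j" 10] mono[of j 10] p10 by auto
    then show "s ! j * (min 1 (p ! Suc j) - min 1 (p ! j)) = s ! j * (p ! Suc j - p ! j)"
      by (simp add: min_def)
  qed
  also have "\<dots> = 0"
  proof -
    define a' where "a' = l1 * (1 - sm * f) / (2 * (sp - sm))"
    define e' where "e' = l2 * (1 + sp * (1 - f)) / (2 * (sp - sm))"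
    have a': "2 * (a' * sp) = 2 * (a' * sm) + l1 * (1 - sm * f)"
      and e': "2 * (e' * sp) = 2 * (e' * sm) + l2 * (1 + sp * (1 - f))"
      using assms(3,4) by (simp_all add: a'_def e'_def field_simps)
    have 1: "1 / f * (f - l1 * f / 2 - l1 * f / 2) = 1 - l1"
      using \<open>0 < f\<close> by (simp add: field_simps)
    have 2: "1 / (f - 1) * (1 - l2 * (1 - f) / 2 - (1 + f - (1 - l2 * (1 - f) / 2))) = l2 - 1"
      using \<open>f < 1\<close> by (simp add: divide_simps) (simp add: algebra_simps)
    have "(\<Sum>j<10. s ! j * (p ! Suc j - p ! j)) =
      sp * a' + sm * (l1 * f / 2 - a') + 1 / f * (f - l1 * f / 2 - l1 * f / 2)
      + sm * (l1 * f / 2 - a') + sp * a' + sm * e' + sp * (l2 * (1 - f) / 2 - e')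
      + 1 / (f - 1) * (1 - l2 * (1 - f) / 2 - (1 + f - (1 - l2 * (1 - f) / 2)))
      + sp * (l2 * (1 - f) / 2 - e') + sm * e'"
      unfolding s_def p_def chen_slopes_def chen_breakpoints_def Let_def
        a'_def[symmetric] e'_def[symmetric]
      by (simp add: eval_nat_numeral lessThan_Suc del: distrib_left_numeral)
    also have "\<dots> = 0"
      unfolding 1 2 using a' e' by (simp add: algebra_simps)
    finally show ?thesis .
  qed
  finally have F1: "F 1 = 0" .
  have F0: "F 0 = 0"
    unfolding F_def
  proof (rule sum.neutral, rule ballI)
    fix j :: nat assume "j \<in> {..<10}"
    then have "p ! Suc j \<ge> 0" "p ! j \<ge> 0" using mono[of 0 "Suc j"] mono[of 0 j] p0 by auto
    then show "s ! j * (min 0 (p ! Suc j) - min 0 (p ! j)) = 0" by simp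
  qed
  have chen: "chen_function f sp sm l1 l2 t = F t" if "0 \<le> t" "t \<le> 1" for t
  proof (cases "t = 1")
    case True
    have "chen_function f sp sm l1 l2 1 = F 0"
      by (simp add: chen_function_def F_def p_def s_def)
    with True F0 F1 show ?thesis by simp
  next
    case False
    with that have "frac t = t" by (simp add: frac_eq)
    then show ?thesis by (simp add: chen_function_def F_def p_def s_def)
  qed
  have bounds: "0 \<le> p ! i" "p ! Suc i \<le> 1"
    using mono[of 0 i] mono[of "Suc i" 10] p0 p10 i by auto
  have "F y - F x = (\<Sum>j<10. if j = i then s ! i * (y - x) else 0)"
    unfolding F_def sum_subtractf[symmetric]
  proof (rule sum.cong[OF refl])
    fix j :: nat assume j: "j \<in> {..<10}"
    consider "j < i" | "j = i" | "i < j" by linarith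
    then show "s ! j * (min y (p ! Suc j) - min y (p ! j)) - s ! j * (min x (p ! Suc j) - min x (p ! j))
      = (if j = i then s ! i * (y - x) else 0)"
    proof cases
      case 1
      then have "p ! j \<le> p ! i" "p ! Suc j \<le> p ! i" using mono i by auto
      then show ?thesis using x y 1 by (auto simp: p_def[symmetric] min_def)
    next
      case 2
      then show ?thesis using x y by (auto simp: p_def[symmetric] min_def algebra_simps)
    next
      case 3
      then have "p ! Suc i \<le> p ! j" "p ! Suc i \<le> p ! Suc j" using mono j by auto
      then show ?thesis using x y 3 by (auto simp: p_def[symmetric] min_def)
    qed
  qed
  also have "\<dots> = s ! i * (y - x)" using i by simp
  finally show ?thesis
    using chen[of x] chen[of y] x y bounds by (simp add: p_def s_def)
qed

lemma chen_conditions_sorted: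
  assumes "0 < f" "f < 1" "sp > 0" "sm < 0" and H: "chen_conditions f sp sm l1 l2"
  shows "sorted (chen_breakpoints f sp sm l1 l2)"
proof -
  have sp: "1 \<le> sp * f" and sm: "1 \<le> sm * (f - 1)"
    using H assms(1-4) by (auto simp: chen_conditions_def field_simps)
  have "1 / sp \<le> f"
    using sp \<open>sp > 0\<close> by (simp add: field_simps)
  then have l: "0 \<le> l1" "l1 < 1/2" "0 \<le> l2" "l2 < 1/2"
    using H by (auto simp: chen_conditions_def)
  define a' where "a' = l1 * (1 - sm * f) / (2 * (sp - sm))"
  define e' where "e' = l2 * (1 + sp * (1 - f)) / (2 * (sp - sm))"
  have "sm * f \<le> 0" "0 \<le> sp * (1 - f)"
    using assms by (auto simp: mult_nonpos_nonneg)
  then have nonneg: "0 \<le> a'" "0 \<le> e'"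
    unfolding a'_def e'_def using l assms by (auto intro!: divide_nonneg_pos mult_nonneg_nonneg)
  have "l1 * (1 - sm * f) \<le> l1 * (f * (sp - sm))"
    using sp l by (intro mult_left_mono) (auto simp: algebra_simps)
  then have a': "a' \<le> l1 * f / 2"
    unfolding a'_def using assms by (simp add: divide_simps) (simp add: algebra_simps)
  have "l2 * (1 + sp * (1 - f)) \<le> l2 * ((1 - f) * (sp - sm))"
    using sm l by (intro mult_left_mono) (auto simp: algebra_simps)
  then have e': "e' \<le> l2 * (1 - f) / 2"
    unfolding e'_def using assms by (simp add: divide_simps) (simp add: algebra_simps)
  have "l1 * f \<le> 1 * f" "l2 * (1 - f) \<le> 1 * (1 - f)"
    using l assms(1,2) by (intro mult_right_mono; simp)+
  moreover define A where "A = l1 * f / 2"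
  moreover define E where "E = l2 * (1 - f) / 2"
  ultimately have AE: "0 \<le> a'" "a' \<le> A" "2 * A \<le> f" "0 \<le> e'" "e' \<le> E" "2 * E \<le> 1 - f"
    using nonneg a' e' by simp_all
  show ?thesis
    unfolding chen_breakpoints_def Let_def
      a'_def[symmetric] e'_def[symmetric] A_def[symmetric] E_def[symmetric]
    using AE assms(1,2) by auto
qed

lemma chen_breakpoints_ordered_example:
  "sorted_wrt (<) (chen_breakpoints (7/10) 2 (-4) (1/10) (1/10))"
  by (simp add: chen_breakpoints_def Let_def)

end

theory Submission
  imports Defs
begin

text \<open>
  A valid function satisfies \<open>\<pi> x + \<pi> y + \<pi> z \<ge> 1\<close> whenever \<open>x + y + z \<equiv> f\<close>, so a valid function
  that is symmetric, \<open>\<pi> x + \<pi> (f - x) = 1\<close>, is subadditive; the first function is symmetric at a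
  point where subadditivity fails.  Conversely a nonnegative periodic subadditive function with
  \<open>\<pi> 0 = 0\<close>, \<open>\<pi> f = 1\<close> is valid.  If a symmetric valid \<open>\<pi>\<close> is the average of valid \<open>\<pi>1\<close>, \<open>\<pi>2\<close>, these
  are symmetric too, hence subadditive, and they are additive wherever \<open>\<pi>\<close> is.  For the
  second function the additivities force \<open>\<pi>1\<close> to be linear on each of the two long pieces, whose
  graphs lie on lines through \<open>(0, 0)\<close> and \<open>(1, 0)\<close>, with slopes fixed by the symmetry.  Two unknown
  slopes at the origin remain, and the short pieces yield a regular linear system for them.
\<close>

section \<open>Valid functions\<close>

lemma sum_list_map_eq_sum_support:
  fixes g :: "'a \<Rightarrow> real"
  shows "sum_list (map g xs) =
    (\<Sum>r | real (count_list xs r) \<noteq> 0. g r * real (count_list xs r))"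
proof -
  have supp: "{r. real (count_list xs r) \<noteq> 0} = set xs"
    by (auto simp: count_list_0_iff)
  have "sum_list (map g xs) = (\<Sum>r\<in>set xs. g r * real (count_list xs r))"
  proof (induction xs)
    case (Cons a xs)
    have "(\<Sum>r\<in>set (a # xs). g r * real (count_list (a # xs) r)) =
        (\<Sum>r\<in>set (a # xs). (if r = a then g r else 0) + g r * real (count_list xs r))"
      by (rule sum.cong) (auto simp: algebra_simps)
    also have "\<dots> = g a + (\<Sum>r\<in>set (a # xs). g r * real (count_list xs r))"
      by (simp only: sum.distrib) simp
    also have "(\<Sum>r\<in>set (a # xs). g r * real (count_list xs r)) =
        (\<Sum>r\<in>set xs. g r * real (count_list xs r))"
      by (rule sum.mono_neutral_right) (auto simp: count_list_0_iff)
    finally show ?case using Cons.IH by simp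
  qed simp
  then show ?thesis unfolding supp .
qed

text \<open>\<open>count_list\<close> turns a list into a finitely supported solution. Repeated
  entries become multiplicities, so coinciding arguments in the two- and three-term inequalities
  need no separate case.\<close>

lemma valid_function_sum_list:
  assumes "valid_function f \<pi>" and "sum_list xs - f \<in> \<int>"
  shows "1 \<le> sum_list (map \<pi> xs)"
proof -
  define y where "y r = real (count_list xs r)" for r
  have "{r. y r \<noteq> 0} = set xs"
    by (auto simp: y_def count_list_0_iff)
  moreover have "(\<Sum>r | y r \<noteq> 0. r * y r) = sum_list xs"
    using sum_list_map_eq_sum_support[of "\<lambda>r. r" xs] by (simp add: y_def)
  ultimately have "y \<in> group_solutions f"
    using assms(2) by (simp add: group_solutions_def) (simp add: y_def)
  then have "y \<in> infinite_group_polyhedron f"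
    unfolding infinite_group_polyhedron_def by (rule hull_inc)
  then have "1 \<le> (\<Sum>r | y r \<noteq> 0. \<pi> r * y r)"
    using assms(1) by (simp add: valid_function_def)
  then show ?thesis
    using sum_list_map_eq_sum_support[of \<pi> xs] by (simp add: y_def)
qed

lemma valid_function_nonneg: "valid_function f \<pi> \<Longrightarrow> 0 \<le> \<pi> r"
  by (simp add: valid_function_def)

lemma valid_function_add2:
  assumes "valid_function f \<pi>" "x + y - f \<in> \<int>"
  shows "1 \<le> \<pi> x + \<pi> y"
  using valid_function_sum_list[OF assms(1), of "[x, y]"] assms(2) by simp

lemma valid_function_add3:
  assumes "valid_function f \<pi>" "x + y + z - f \<in> \<int>"
  shows "1 \<le> \<pi> x + \<pi> y + \<pi> z"
  using valid_function_sum_list[OF assms(1), of "[x, y, z]"] assms(2) by (simp add: add.assoc)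

lemma valid_symmetric_subadditive:
  assumes "valid_function f \<pi>" "\<pi> (x + y) + \<pi> (f - (x + y)) = 1"
  shows "\<pi> (x + y) \<le> \<pi> x + \<pi> y"
  using valid_function_add3[OF assms(1), of x y "f - (x + y)"] assms(2) by simp

text \<open>If u - v is an integer, then u + (f - v) is congruent to f, so 1 <= \<pi> u + \<pi> (f -
  v) = \<pi> u + 1 - \<pi> v. Exchanging u and v gives equality.\<close>

lemma valid_symmetric_periodic:
  assumes valid: "valid_function f \<pi>" and symm: "\<And>x. \<pi> x + \<pi> (f - x) = 1" and "x - y \<in> \<int>"
  shows "\<pi> x = \<pi> y"
proof -
  have *: "\<pi> v \<le> \<pi> u" if "u - v \<in> \<int>" for u v
    using valid_function_add2[OF valid, of u "f - v"] symm[of v] that by simp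
  have "y - x \<in> \<int>"
    using Ints_minus[OF \<open>x - y \<in> \<int>\<close>] by simp
  with * assms(3) show ?thesis by (meson order_antisym)
qed

section \<open>Validity from subadditivity\<close>

lemma subadditive_nat_multiple:
  assumes "subadditive_function \<pi>" "\<pi> 0 = 0"
  shows "\<pi> (r * real n) \<le> \<pi> r * real n"
proof (induction n)
  case (Suc n)
  have "\<pi> (r + r * real n) \<le> \<pi> r + \<pi> (r * real n)"
    using assms(1) by (simp add: subadditive_function_def)
  with Suc show ?case by (simp add: algebra_simps)
qed (simp add: assms)

lemma subadditive_sum:
  assumes sub: "subadditive_function \<pi>" and "\<pi> 0 = 0" and "finite S" and "\<And>r. r \<in> S \<Longrightarrow> y r \<in> \<nat>"
  shows "\<pi> (\<Sum>r\<in>S. r * y r) \<le> (\<Sum>r\<in>S. \<pi> r * y r)"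
  using assms(3,4)
proof (induction S)
  case (insert a S)
  obtain n where n: "y a = real n"
    using insert.prems[of a] by (auto elim: Nats_cases)
  have "\<pi> (a * y a + (\<Sum>r\<in>S. r * y r)) \<le> \<pi> (a * y a) + \<pi> (\<Sum>r\<in>S. r * y r)"
    using sub by (simp add: subadditive_function_def)
  also have "\<dots> \<le> \<pi> a * y a + (\<Sum>r\<in>S. \<pi> r * y r)"
    using insert subadditive_nat_multiple[OF sub \<open>\<pi> 0 = 0\<close>, of a n] n
    by (intro add_mono) auto
  finally show ?case using insert.hyps by simp
qed (simp add: assms)

text \<open>The defining inequality is linear in \<open>y\<close>, so it passes from the solutions
  to their convex hull.\<close>

lemma valid_function_on_group_solutions:
  assumes nonneg: "\<And>r. 0 \<le> \<pi> r"
    and solutions: "\<And>y. y \<in> group_solutions f \<Longrightarrow> 1 \<le> (\<Sum>r | y r \<noteq> 0. \<pi> r * y r)"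
  shows "valid_function f \<pi>"
proof -
  define C :: "(real \<Rightarrow> real) set"
    where "C = {y. finite {r. y r \<noteq> 0} \<and> 1 \<le> (\<Sum>r | y r \<noteq> 0. \<pi> r * y r)}"
  \<comment> \<open>The index set varies with \<open>y\<close>; over a common finite superset of the
    supports the sum is linear in \<open>y\<close>.\<close>
  have extend: "(\<Sum>r | y r \<noteq> 0. \<pi> r * y r) = (\<Sum>r\<in>S. \<pi> r * y r)"
    if "finite S" "{r. y r \<noteq> 0} \<subseteq> S" for S and y :: "real \<Rightarrow> real"
    using that by (intro sum.mono_neutral_left) auto
  have "convex C"
  proof (rule convexI)
    fix x y :: "real \<Rightarrow> real" and u v :: real
    assume x: "x \<in> C" and y: "y \<in> C" and uv: "0 \<le> u" "0 \<le> v" "u + v = 1"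
    define S where "S = {r. x r \<noteq> 0} \<union> {r. y r \<noteq> 0}"
    let ?z = "u *\<^sub>R x + v *\<^sub>R y"
    have z: "?z r = u * x r + v * y r" for r
      by (simp add: scaleR_fun_def)
    have S: "finite S" "{r. x r \<noteq> 0} \<subseteq> S" "{r. y r \<noteq> 0} \<subseteq> S" "{r. ?z r \<noteq> 0} \<subseteq> S"
      using x y unfolding z by (auto simp: C_def S_def)
    have "1 \<le> u * (\<Sum>r\<in>S. \<pi> r * x r) + v * (\<Sum>r\<in>S. \<pi> r * y r)"
      using x y uv convex_bound_le[of "- (\<Sum>r\<in>S. \<pi> r * x r)" "-1" "- (\<Sum>r\<in>S. \<pi> r * y r)" u v]
      by (simp add: C_def extend[OF S(1,2)] extend[OF S(1,3)])
    also have "\<dots> = (\<Sum>r\<in>S. \<pi> r * ?z r)"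
      unfolding z by (simp add: sum_distrib_left sum.distrib[symmetric] algebra_simps)
    finally have "1 \<le> (\<Sum>r\<in>S. \<pi> r * ?z r)" .
    then show "?z \<in> C"
      using finite_subset[OF S(4,1)] by (simp only: C_def mem_Collect_eq extend[OF S(1,4)])
  qed
  moreover have "group_solutions f \<subseteq> C"
    using solutions by (auto simp: C_def group_solutions_def)
  ultimately have "infinite_group_polyhedron f \<subseteq> C"
    unfolding infinite_group_polyhedron_def by (rule hull_minimal[rotated])
  with nonneg show ?thesis
    by (auto simp: valid_function_def C_def)
qed

lemma subadditive_valid:
  assumes "\<And>r. 0 \<le> \<pi> r" and "subadditive_function \<pi>" and "\<pi> 0 = 0"
    and one: "\<And>x. x - f \<in> \<int> \<Longrightarrow> 1 \<le> \<pi> x"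
  shows "valid_function f \<pi>"
proof (rule valid_function_on_group_solutions)
  fix y assume y: "y \<in> group_solutions f"
  then have "1 \<le> \<pi> (\<Sum>r | y r \<noteq> 0. r * y r)"
    by (intro one) (simp add: group_solutions_def)
  also have "\<dots> \<le> (\<Sum>r | y r \<noteq> 0. \<pi> r * y r)"
    using y assms by (intro subadditive_sum) (auto simp: group_solutions_def)
  finally show "1 \<le> (\<Sum>r | y r \<noteq> 0. \<pi> r * y r)" .
qed (fact assms(1))

section \<open>Additive functions on an interval\<close>

text \<open>Iterating the improvement bounds g by M / 2^n for every n. This lets boundedness do the
  work of continuity in Cauchy's equation below.\<close>

lemma eq_0_if_halving:
  fixes g :: "'a \<Rightarrow> real"
  assumes bound: "\<And>x. x \<in> S \<Longrightarrow> \<bar>g x\<bar> \<le> M"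
    and halve: "\<And>M x. (\<And>y. y \<in> S \<Longrightarrow> \<bar>g y\<bar> \<le> M) \<Longrightarrow> x \<in> S \<Longrightarrow> \<bar>g x\<bar> \<le> M / 2"
    and "x \<in> S"
  shows "g x = 0"
proof -
  have "\<forall>x\<in>S. \<bar>g x\<bar> \<le> M / 2 ^ n" for n
  proof (induction n)
    case (Suc n)
    have "\<bar>g x\<bar> \<le> M / 2 ^ n / 2" if "x \<in> S" for x
      using Suc that by (intro halve) auto
    then show ?case by (simp add: field_simps)
  qed (simp add: bound)
  then have le: "\<bar>g x\<bar> \<le> M / 2 ^ n" for n
    using \<open>x \<in> S\<close> by blast
  have "(\<lambda>n. M / 2 ^ n) \<longlonglongrightarrow> 0"
    by (rule LIMSEQ_divide_realpow_zero) simp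
  then have "\<bar>g x\<bar> \<le> 0"
    by (rule LIMSEQ_le_const) (use le in auto)
  then show ?thesis by simp
qed

text \<open>The deviation g from the chord is additive and vanishes at A. Doubling halves its bound
  on the lower half of [0, A], and g x = - g (A - x) carries this to the upper half.\<close>

lemma additive_from_0_linear:
  fixes h :: "real \<Rightarrow> real"
  assumes "0 < A" and bound: "\<And>x. 0 \<le> x \<Longrightarrow> x \<le> A \<Longrightarrow> \<bar>h x\<bar> \<le> M"
    and add: "\<And>x y. 0 \<le> x \<Longrightarrow> 0 \<le> y \<Longrightarrow> x + y \<le> A \<Longrightarrow> h (x + y) = h x + h y"
    and x: "0 \<le> x" "x \<le> A"
  shows "h x = h A / A * x"
proof -
  define g where "g x = h x - h A / A * x" for x
  have g_add: "g (x + y) = g x + g y" if "0 \<le> x" "0 \<le> y" "x + y \<le> A" for x y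
    using add[OF that] by (simp only: g_def distrib_left)
  have gA: "g A = 0"
    using \<open>0 < A\<close> by (simp add: g_def)
  have "g x = 0"
  proof (rule eq_0_if_halving[where g = g and x = x and S = "{0..A}" and M = "M + \<bar>h A\<bar>"])
    fix x assume x: "x \<in> {0..A}"
    have "\<bar>h A / A * x\<bar> = \<bar>h A\<bar> / A * x"
      using x \<open>0 < A\<close> by (simp add: abs_mult)
    also have "\<dots> \<le> \<bar>h A\<bar> / A * A"
      using x \<open>0 < A\<close> by (intro mult_left_mono) auto
    finally have "\<bar>h A / A * x\<bar> \<le> \<bar>h A\<bar>"
      using \<open>0 < A\<close> by simp
    then show "\<bar>g x\<bar> \<le> M + \<bar>h A\<bar>"
      using bound[of x] x unfolding g_def atLeastAtMost_iff by linarith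
  next
    fix M x assume M: "\<And>y. y \<in> {0..A} \<Longrightarrow> \<bar>g y\<bar> \<le> M" and x: "x \<in> {0..A}"
    have low: "\<bar>g y\<bar> \<le> M / 2" if "0 \<le> y" "2 * y \<le> A" for y
      using g_add[of y y] M[of "2 * y"] that by simp
    show "\<bar>g x\<bar> \<le> M / 2"
    proof (cases "2 * x \<le> A")
      case False
      then show ?thesis
        using low[of "A - x"] g_add[of x "A - x"] gA x by auto
    qed (use low x in auto)
  qed (use x in auto)
  then show ?thesis by (simp add: g_def)
qed

text \<open>Additivity is given only away from both ends of [0, F], so the slope 1 / F has to come
  from the symmetry. The margin F / 20 is half of \<lambda>1 = \<lambda>2 = 1/10 times F; it will be
  used with F = 7/10 to the right of 0 and F = 3/10 to the left.\<close>

lemma additive_symmetric_linear: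
  fixes h :: "real \<Rightarrow> real"
  assumes "0 < F" and bound: "\<And>x. F / 20 \<le> x \<Longrightarrow> x \<le> 19 * F / 20 \<Longrightarrow> \<bar>h x\<bar> \<le> M"
    and add: "\<And>x y. F / 20 \<le> x \<Longrightarrow> F / 20 \<le> y \<Longrightarrow> x + y \<le> 19 * F / 20 \<Longrightarrow> h (x + y) = h x + h y"
    and symm: "\<And>x. F / 20 \<le> x \<Longrightarrow> x \<le> 19 * F / 20 \<Longrightarrow> h x + h (F - x) = 1"
    and x: "F / 20 \<le> x" "x \<le> 19 * F / 20"
  shows "h x = x / F"
proof -
  define g where "g x = h x - x / F" for x
  have g_add: "g (x + y) = g x + g y" if "F / 20 \<le> x" "F / 20 \<le> y" "x + y \<le> 19 * F / 20" for x y
    using add[OF that] by (simp add: g_def add_divide_distrib)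
  have g_symm: "g (F - x) = - g x" if "F / 20 \<le> x" "x \<le> 19 * F / 20" for x
    using symm[OF that] \<open>0 < F\<close> by (simp add: g_def diff_divide_distrib)
  have "g x = 0"
  proof (rule eq_0_if_halving[where g = g and x = x and S = "{F / 20..19 * F / 20}" and M = "M + 1"])
    fix x assume x: "x \<in> {F / 20..19 * F / 20}"
    then have "0 \<le> x" "x \<le> F"
      using \<open>0 < F\<close> by auto
    then have "0 \<le> x / F" "x / F \<le> 1"
      using \<open>0 < F\<close> by simp_all
    then show "\<bar>g x\<bar> \<le> M + 1"
      using bound[of x] x unfolding g_def atLeastAtMost_iff by argo
  next
    fix M x assume M: "\<And>y. y \<in> {F / 20..19 * F / 20} \<Longrightarrow> \<bar>g y\<bar> \<le> M"
      and x: "x \<in> {F / 20..19 * F / 20}"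
    have low: "\<bar>g y\<bar> \<le> M / 2" if "F / 20 \<le> y" "2 * y \<le> 19 * F / 20" for y
      using g_add[of y y] M[of "2 * y"] that \<open>0 < F\<close> by simp
    consider "2 * x \<le> 19 * F / 20" | "2 * F - 2 * x \<le> 19 * F / 20"
      | "19 * F / 40 \<le> x" "x \<le> 21 * F / 40"
      by linarith
    then show "\<bar>g x\<bar> \<le> M / 2"
    proof cases
      case 1
      then show ?thesis using low x by auto
    next
      case 2
      then show ?thesis using low[of "F - x"] g_symm[of x] x by auto
    next
      \<comment> \<open>Near the centre neither \<open>2 * x\<close> nor its reflection is available; pass to \<open>4 / 3 * x\<close>.\<close>
      case 3
      have "g x = 3 * g (x / 3)"
        using g_add[of "x / 3" "2 * x / 3"] g_add[of "x / 3" "x / 3"] 3 \<open>0 < F\<close> by simp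
      moreover have "g (4 * x / 3) = 4 * g (x / 3)"
        using g_add[of "2 * x / 3" "2 * x / 3"] g_add[of "x / 3" "x / 3"] 3 \<open>0 < F\<close> by simp
      moreover have "\<bar>g (4 * x / 3)\<bar> \<le> M / 2"
        using low[of "F - 4 * x / 3"] g_symm[of "4 * x / 3"] 3 \<open>0 < F\<close> by simp
      ultimately show ?thesis by linarith
    qed
  qed (use x in auto)
  then show ?thesis by (simp add: g_def)
qed

section \<open>The extreme function\<close>

abbreviation chen_ex :: "real \<Rightarrow> real"
  where "chen_ex \<equiv> chen_function (7/10) 2 (-4) (1/10) (1/10)"

section \<open>Explicit pieces, subadditivity and validity\<close>

lemma chen_function_cong_Ints:
  assumes "x - y \<in> \<int>"
  shows "chen_function f sp sm l1 l2 x = chen_function f sp sm l1 l2 y"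
proof -
  obtain k where "x = y + of_int k"
    using assms by (metis Ints_cases add.commute diff_add_cancel)
  then have "frac x = frac y"
    by (simp add: frac_def)
  then show ?thesis by (simp add: chen_function_def)
qed

text \<open>The graph over [0, 1] as a disjunction of linear constraints, with shared endpoints:
  claims about the function become finite case splits settled by linear arithmetic.\<close>

definition chen_piece :: "real \<Rightarrow> real \<Rightarrow> bool"
  where "chen_piece x v \<longleftrightarrow>
    0 \<le> x \<and> x \<le> 19/600 \<and> v = 2 * x \<or>
    19/600 \<le> x \<and> x \<le> 21/600 \<and> v = 19/100 - 4 * x \<or>
    21/600 \<le> x \<and> x \<le> 399/600 \<and> v = 10/7 * x \<or>
    399/600 \<le> x \<and> x \<le> 401/600 \<and> v = 361/100 - 4 * x \<or>
    401/600 \<le> x \<and> x \<le> 7/10 \<and> v = 2 * x - 4/10 \<or>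
    7/10 \<le> x \<and> x \<le> 428/600 \<and> v = 38/10 - 4 * x \<or>
    428/600 \<le> x \<and> x \<le> 429/600 \<and> v = 2 * x - 48/100 \<or>
    429/600 \<le> x \<and> x \<le> 591/600 \<and> v = 10/3 - 10/3 * x \<or>
    591/600 \<le> x \<and> x \<le> 592/600 \<and> v = 2 * x - 192/100 \<or>
    592/600 \<le> x \<and> x \<le> 1 \<and> v = 4 - 4 * x"

lemma chen_piece_chen_ex:
  assumes "0 \<le> x" "x \<le> 1"
  shows "chen_piece x (chen_ex x)"
proof (cases "x = 1")
  case True
  have "chen_ex 1 = chen_ex 0"
    by (rule chen_function_cong_Ints) simp
  also have "\<dots> = 0"
    by (rule chen_function_0) (simp add: chen_breakpoints_def Let_def)
  finally show ?thesis
    using True by (simp add: chen_piece_def)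
next
  case False
  with assms have "frac x = x"
    by (simp add: frac_eq)
  then have eq: "chen_ex x =
      2 * (min x (19/600) - min x 0) - 4 * (min x (21/600) - min x (19/600)) +
      10/7 * (min x (399/600) - min x (21/600)) - 4 * (min x (401/600) - min x (399/600)) +
      2 * (min x (7/10) - min x (401/600)) - 4 * (min x (428/600) - min x (7/10)) +
      2 * (min x (429/600) - min x (428/600)) - 10/3 * (min x (591/600) - min x (429/600)) +
      2 * (min x (592/600) - min x (591/600)) - 4 * (min x 1 - min x (592/600))"
    unfolding chen_function_def chen_slopes_def chen_breakpoints_def Let_def
    by (simp add: eval_nat_numeral lessThan_Suc del: distrib_left_numeral)
  consider "x \<le> 19/600" | "19/600 \<le> x" "x \<le> 21/600" | "21/600 \<le> x" "x \<le> 399/600"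
    | "399/600 \<le> x" "x \<le> 401/600" | "401/600 \<le> x" "x \<le> 7/10" | "7/10 \<le> x" "x \<le> 428/600"
    | "428/600 \<le> x" "x \<le> 429/600" | "429/600 \<le> x" "x \<le> 591/600"
    | "591/600 \<le> x" "x \<le> 592/600" | "592/600 \<le> x"
    by linarith
  then show ?thesis
    using assms unfolding chen_piece_def eq
    by cases (simp_all add: min_def, auto simp: field_simps)
qed

text \<open>For each choice of pieces for x, y, z and each of the two reductions modulo 1, the claim
  is a linear inequality under linear constraints; impossible choices have contradictory
  constraints.\<close>

lemma chen_piece_subadditive:
  assumes "chen_piece x u" "chen_piece y v" "chen_piece z w" "z = x + y \<or> z = x + y - 1"
  shows "w \<le> u + v"
  using assms(1)[unfolded chen_piece_def]
  by (elim disjE conjE)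
    (insert assms(2-4), unfold chen_piece_def, (elim disjE conjE, linarith+)+)

lemma chen_ex_frac: "chen_ex (frac x) = chen_ex x"
  by (rule chen_function_cong_Ints) (simp add: frac_def)

lemma chen_piece_frac: "chen_piece (frac x) (chen_ex x)"
  using chen_piece_chen_ex[of "frac x"] frac_ge_0[of x] frac_lt_1[of x] by (simp add: chen_ex_frac)

lemma chen_ex_subadditive: "subadditive_function chen_ex"
  unfolding subadditive_function_def
proof (intro allI)
  fix x y :: real
  show "chen_ex (x + y) \<le> chen_ex x + chen_ex y"
    by (rule chen_piece_subadditive[OF chen_piece_frac chen_piece_frac chen_piece_frac])
      (simp add: frac_add)
qed

lemma chen_ex_nonneg: "0 \<le> chen_ex x"
  using chen_piece_frac[of x] unfolding chen_piece_def
  by - (elim disjE conjE, simp_all)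

lemma chen_piece_symmetric:
  assumes "chen_piece x u" "chen_piece y v" "y = 7/10 - x \<or> y = 17/10 - x"
  shows "u + v = 1"
  using assms unfolding chen_piece_def by - (elim disjE conjE, linarith+)

lemma chen_ex_symmetric: "chen_ex x + chen_ex (7/10 - x) = 1"
proof -
  \<comment> \<open>The representative of 7/10 - x modulo 1 that lies in [0, 1].\<close>
  define y where "y = (if frac x \<le> 7/10 then 7/10 - frac x else 17/10 - frac x)"
  have "(7/10 - x) - y \<in> \<int>"
    by (simp add: frac_def y_def)
  then have "chen_ex (7/10 - x) = chen_ex y"
    by (rule chen_function_cong_Ints)
  moreover have "chen_piece y (chen_ex y)"
    using frac_ge_0[of x] frac_lt_1[of x]
    by (intro chen_piece_chen_ex; simp add: y_def; linarith?)
  ultimately show ?thesis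
    using chen_piece_symmetric[OF chen_piece_frac, of y "chen_ex y" x] by (simp add: y_def)
qed

lemma chen_ex_0: "chen_ex 0 = 0"
  using chen_piece_chen_ex[of 0] by (simp add: chen_piece_def)

lemma chen_ex_valid: "valid_function (7/10) chen_ex"
proof (rule subadditive_valid[OF chen_ex_nonneg chen_ex_subadditive chen_ex_0])
  fix x :: real assume "x - 7/10 \<in> \<int>"
  then have "chen_ex x = chen_ex (7/10)"
    by (rule chen_function_cong_Ints)
  then show "1 \<le> chen_ex x"
    using chen_ex_symmetric[of 0] by (simp add: chen_ex_0)
qed

section \<open>Rigidity: formulas around the origin and uniqueness\<close>

lemma chen_ex_pos:
  shows "0 \<le> x \<Longrightarrow> x \<le> 19/600 \<Longrightarrow> chen_ex x = 2 * x"
    and "19/600 \<le> x \<Longrightarrow> x \<le> 21/600 \<Longrightarrow> chen_ex x = 19/100 - 4 * x"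
    and "21/600 \<le> x \<Longrightarrow> x \<le> 399/600 \<Longrightarrow> chen_ex x = 10/7 * x"
proof -
  have p: "chen_piece x (chen_ex x)" if "0 \<le> x" "x \<le> 399/600"
    using that by (intro chen_piece_chen_ex) linarith+
  show "0 \<le> x \<Longrightarrow> x \<le> 19/600 \<Longrightarrow> chen_ex x = 2 * x"
    and "19/600 \<le> x \<Longrightarrow> x \<le> 21/600 \<Longrightarrow> chen_ex x = 19/100 - 4 * x"
    and "21/600 \<le> x \<Longrightarrow> x \<le> 399/600 \<Longrightarrow> chen_ex x = 10/7 * x"
    by (use p in \<open>simp add: chen_piece_def, argo\<close>)+
qed

text \<open>Moving the pieces next to 1 to the left of 0 makes the first and third of them
  proportional to t, hence additive in t.\<close>

lemma chen_ex_neg: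
  shows "0 \<le> t \<Longrightarrow> t \<le> 8/600 \<Longrightarrow> chen_ex (- t) = 4 * t"
    and "8/600 \<le> t \<Longrightarrow> t \<le> 9/600 \<Longrightarrow> chen_ex (- t) = 8/100 - 2 * t"
    and "9/600 \<le> t \<Longrightarrow> t \<le> 171/600 \<Longrightarrow> chen_ex (- t) = 10/3 * t"
proof -
  have "chen_ex (- t) = chen_ex (1 - t)"
    by (rule chen_function_cong_Ints) simp
  then have p: "chen_piece (1 - t) (chen_ex (- t))" if "0 \<le> t" "t \<le> 1"
    using chen_piece_chen_ex[of "1 - t"] that by simp
  show "0 \<le> t \<Longrightarrow> t \<le> 8/600 \<Longrightarrow> chen_ex (- t) = 4 * t"
    and "8/600 \<le> t \<Longrightarrow> t \<le> 9/600 \<Longrightarrow> chen_ex (- t) = 8/100 - 2 * t"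
    and "9/600 \<le> t \<Longrightarrow> t \<le> 171/600 \<Longrightarrow> chen_ex (- t) = 10/3 * t"
    by (use p in \<open>simp add: chen_piece_def, argo\<close>)+
qed

text \<open>Modulo 1 the symmetry reflects about 7/20 and about -3/20. Within the period
  [-3/10, 7/10], the first reflection sends points above 399/600 into [0, 21/600], and the second
  sends points below -171/600 into [-9/600, 0].\<close>

lemma symmetric_determined:
  fixes \<phi> \<psi> :: "real \<Rightarrow> real"
  assumes symm1: "\<And>x. \<phi> x + \<phi> (7/10 - x) = 1" and symm2: "\<And>x. \<psi> x + \<psi> (7/10 - x) = 1"
    and per1: "\<And>x y. x - y \<in> \<int> \<Longrightarrow> \<phi> x = \<phi> y" and per2: "\<And>x y. x - y \<in> \<int> \<Longrightarrow> \<psi> x = \<psi> y"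
    and eq: "\<And>x. - 171/600 \<le> x \<Longrightarrow> x \<le> 399/600 \<Longrightarrow> \<phi> x = \<psi> x"
  shows "\<phi> = \<psi>"
proof
  fix x :: real
  define z where "z = frac (x + 3/10) - 3/10"
  have z: "- 3/10 \<le> z" "z \<le> 7/10"
    using frac_ge_0[of "x + 3/10"] frac_lt_1[of "x + 3/10"] unfolding z_def by linarith+
  have "\<phi> z = \<psi> z"
  proof -
    consider "- 171/600 \<le> z" "z \<le> 399/600" | "399/600 \<le> z" | "z \<le> - 171/600"
      by linarith
    then show ?thesis
    proof cases
      case 2
      then show ?thesis
        using eq[of "7/10 - z"] symm1[of z] symm2[of z] z by simp
    next
      case 3
      then show ?thesis
        using eq[of "- 3/10 - z"] symm1[of z] symm2[of z] z
          per1[of "7/10 - z" "- 3/10 - z"] per2[of "7/10 - z" "- 3/10 - z"] by simp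
    qed (rule eq)
  qed
  moreover have "x - z \<in> \<int>"
    by (simp add: z_def frac_def)
  ultimately show "\<phi> x = \<psi> x"
    using per1 per2 by metis
qed

lemma chen_ex_determined:
  fixes \<phi> :: "real \<Rightarrow> real"
  assumes symm: "\<And>x. \<phi> x + \<phi> (7/10 - x) = 1"
    and per: "\<And>x y. x - y \<in> \<int> \<Longrightarrow> \<phi> x = \<phi> y"
    and bound: "\<And>x. \<bar>\<phi> x\<bar> \<le> M"
    and add: "\<And>x y. chen_ex (x + y) = chen_ex x + chen_ex y \<Longrightarrow> \<phi> (x + y) = \<phi> x + \<phi> y"
  shows "\<phi> = chen_ex"
proof (rule symmetric_determined)
  \<comment> \<open>The two unknown rates of increase when leaving 0 to the right and to the
    left.\<close>
  define \<sigma> \<tau> where "\<sigma> = \<phi> (19/600) / (19/600)" and "\<tau> = \<phi> (- (8/600)) / (8/600)"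
  have right: "\<phi> x = x / (7/10)" if "21/600 \<le> x" "x \<le> 399/600" for x
    by (rule additive_symmetric_linear[where M = M])
      (use symm bound that in \<open>auto intro!: add simp: chen_ex_pos\<close>)
  have left: "\<phi> (- t) = t / (3/10)" if "9/600 \<le> t" "t \<le> 171/600" for t
  proof (rule additive_symmetric_linear[OF _ bound])
    fix x y :: real assume "3/10/20 \<le> x" "3/10/20 \<le> y" "x + y \<le> 19 * (3/10)/20"
    then show "\<phi> (- (x + y)) = \<phi> (- x) + \<phi> (- y)"
      using add[of "- x" "- y"] chen_ex_neg(3)[of x] chen_ex_neg(3)[of y] chen_ex_neg(3)[of "x + y"]
      by simp
  next
    fix x :: real
    \<comment> \<open>The arguments differ by 1, so the symmetry becomes invariance of t and 3/10 -
      t, which is the case F = 3/10.\<close>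
    have "\<phi> (7/10 + x) = \<phi> (- (3/10 - x))"
      by (rule per) simp
    then show "\<phi> (- x) + \<phi> (- (3/10 - x)) = 1"
      using symm[of "- x"] by simp
  qed (use that in auto)
  have inner_right: "\<phi> x = \<sigma> * x" if "0 \<le> x" "x \<le> 19/600" for x
    unfolding \<sigma>_def
    by (rule additive_from_0_linear[OF _ bound])
      (use that in \<open>auto intro!: add simp: chen_ex_pos\<close>)
  have inner_left: "\<phi> (- t) = \<tau> * t" if "0 \<le> t" "t \<le> 8/600" for t
    unfolding \<tau>_def
  proof (rule additive_from_0_linear[OF _ bound])
    fix x y :: real assume "0 \<le> x" "0 \<le> y" "x + y \<le> 8/600"
    then show "\<phi> (- (x + y)) = \<phi> (- x) + \<phi> (- y)"
      using add[of "- x" "- y"] chen_ex_neg(1)[of x] chen_ex_neg(1)[of y] chen_ex_neg(1)[of "x + y"]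
      by simp
  qed (use that in auto)
  \<comment> \<open>The piece has the same slope -4 as the short piece left of 0, so
    \<open>chen_ex\<close> is additive for 21/600 and the negative offset to x. The value 1/20 at
    21/600 comes from \<open>right\<close>. \<open>mid_left\<close> mirrors this with slope
    2.\<close>
  have mid_right: "\<phi> x = 1/20 + \<tau> * (21/600 - x)" if "19/600 \<le> x" "x \<le> 21/600" for x
    using add[of "21/600" "- (21/600 - x)"] chen_ex_pos(2)[of x] chen_ex_pos(2)[of "21/600"]
      chen_ex_neg(1)[of "21/600 - x"] inner_left[of "21/600 - x"] right[of "21/600"] that
    by simp
  have mid_left: "\<phi> (- t) = 1/20 + \<sigma> * (9/600 - t)" if "8/600 \<le> t" "t \<le> 9/600" for t
    using add[of "- (9/600)" "9/600 - t"] chen_ex_neg(2)[of t] chen_ex_neg(2)[of "9/600"]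
      chen_ex_pos(1)[of "9/600 - t"] inner_right[of "9/600 - t"] left[of "9/600"] that
    by simp
  \<comment> \<open>Adjacent formulas agree at 19/600 and at -8/600: 19 \<sigma> - 2 \<tau> = 30 and
    8 \<tau> - \<sigma> = 30, with determinant 150.\<close>
  have "\<sigma> * (19/600) = 1/20 + \<tau> * (2/600)" "\<tau> * (8/600) = 1/20 + \<sigma> * (1/600)"
    using mid_right[of "19/600"] inner_right[of "19/600"] mid_left[of "8/600"] inner_left[of "8/600"]
    by simp_all
  then have slopes: "\<sigma> = 2" "\<tau> = 4"
    by simp_all
  fix x :: real assume x: "- 171/600 \<le> x" "x \<le> 399/600"
  consider "0 \<le> x" "x \<le> 19/600" | "19/600 \<le> x" "x \<le> 21/600" | "21/600 \<le> x"
    | "0 \<le> - x" "- x \<le> 8/600" | "8/600 \<le> - x" "- x \<le> 9/600" | "9/600 \<le> - x"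
    by linarith
  then show "\<phi> x = chen_ex x"
  proof cases
    case 1 then show ?thesis by (simp add: inner_right chen_ex_pos slopes)
  next
    case 2 then show ?thesis by (simp add: mid_right chen_ex_pos slopes)
  next
    case 3 then show ?thesis using x by (simp add: right chen_ex_pos)
  next
    case 4 then show ?thesis using inner_left[of "- x"] chen_ex_neg(1)[of "- x"] by (simp add: slopes)
  next
    case 5 then show ?thesis using mid_left[of "- x"] chen_ex_neg(2)[of "- x"] by (simp add: slopes)
  next
    case 6 then show ?thesis using left[of "- x"] chen_ex_neg(3)[of "- x"] x by simp
  qed
qed (use symm chen_ex_symmetric per chen_function_cong_Ints in auto)

text \<open>Validity makes both symmetric sums at least 1, and their mean is 1.\<close>

lemma average_symmetric:
  assumes "\<pi> x + \<pi> (f - x) = 1" "valid_function f \<pi>1" "valid_function f \<pi>2"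
    and "\<And>x. \<pi> x = 1/2 * (\<pi>1 x + \<pi>2 x)"
  shows "\<pi>1 x + \<pi>1 (f - x) = 1"
  using valid_function_add2[OF assms(2), of x "f - x"] valid_function_add2[OF assms(3), of x "f - x"]
    assms(1) assms(4)[of x] assms(4)[of "f - x"] by simp argo

lemma chen_ex_average:
  assumes valid: "valid_function (7/10) \<pi>1" "valid_function (7/10) \<pi>2"
    and avg: "\<And>x. chen_ex x = 1/2 * (\<pi>1 x + \<pi>2 x)"
  shows "\<pi>1 = chen_ex"
proof (rule chen_ex_determined)
  have avg': "chen_ex x = 1/2 * (\<pi>2 x + \<pi>1 x)" for x
    using avg[of x] by simp
  show symm1: "\<pi>1 x + \<pi>1 (7/10 - x) = 1" for x
    using average_symmetric[OF chen_ex_symmetric valid avg] .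
  have symm2: "\<pi>2 x + \<pi>2 (7/10 - x) = 1" for x
    using average_symmetric[OF chen_ex_symmetric valid(2,1) avg'] .
  show "\<pi>1 x = \<pi>1 y" if "x - y \<in> \<int>" for x y
    using valid_symmetric_periodic[OF valid(1) symm1 that] .
  show "\<bar>\<pi>1 x\<bar> \<le> 1" for x
    using symm1[of x] valid_function_nonneg[OF valid(1), of x]
      valid_function_nonneg[OF valid(1), of "7/10 - x"] by simp
  \<comment> \<open>Both summands are subadditive; if their average is additive at (x, y), neither
    inequality can be strict.\<close>
  show "\<pi>1 (x + y) = \<pi>1 x + \<pi>1 y" if "chen_ex (x + y) = chen_ex x + chen_ex y" for x y
    using valid_symmetric_subadditive[OF valid(1) symm1, of x y]
      valid_symmetric_subadditive[OF valid(2) symm2, of x y] that avg[of x] avg[of y] avg[of "x + y"]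
    by argo
qed

lemma chen_ex_extreme: "extreme_function (7/10) chen_ex"
  unfolding extreme_function_def
proof (intro conjI allI impI chen_ex_valid; elim conjE)
  fix \<pi>1 \<pi>2 :: "real \<Rightarrow> real"
  assume valid: "valid_function (7/10) \<pi>1" "valid_function (7/10) \<pi>2"
    and avg: "\<forall>x. chen_ex x = 1/2 * (\<pi>1 x + \<pi>2 x)"
  show "\<pi>1 = chen_ex"
    using chen_ex_average[OF valid] avg by simp
  show "\<pi>2 = chen_ex"
    using chen_ex_average[OF valid(2,1)] avg by (simp add: add.commute)
qed

section \<open>The function that is not subadditive\<close>

text \<open>Here 7/2000 and 1853/2000 are the breakpoints a and c, both convex kinks. Their sum
  93/100 still lies in [c, c'], where the slope is s+ = 2, so the increase from c is 2 a = 7/1000,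
  exceeding the value a / f = 1/200 at a.\<close>

lemma chen_not_subadditive_values:
  defines "\<pi> \<equiv> chen_function (7/10) 2 (-4) (1/100) (49/100)"
  shows "\<pi> (1853/2000) = 49/200" "\<pi> (7/2000) = 1/200" "\<pi> (93/100) = 63/250" "\<pi> (77/100) = 187/250"
  unfolding \<pi>_def chen_function_def chen_slopes_def chen_breakpoints_def Let_def
  by (simp_all add: eval_nat_numeral lessThan_Suc frac_eq min_def)

theorem mainTheorem3:
  shows "\<not> (\<forall>f sp sm l1 l2 :: real. 0 < f \<and> f < 1 \<and> sp > 0 \<and> sm < 0 \<longrightarrow>
            chen_conditions f sp sm l1 l2 \<longrightarrow> extreme_function f (chen_function f sp sm l1 l2))
       \<and> \<not> (\<forall>f sp sm l1 l2 :: real. 0 < f \<and> f < 1 \<and> sp > 0 \<and> sm < 0 \<longrightarrow>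
            extreme_function f (chen_function f sp sm l1 l2) \<longrightarrow> chen_conditions f sp sm l1 l2)
       \<and> (chen_conditions (7/10) 2 (-4) (1/100) (49/100) \<and>
          \<not> subadditive_function (chen_function (7/10) 2 (-4) (1/100) (49/100)) \<and>
          \<not> extreme_function (7/10) (chen_function (7/10) 2 (-4) (1/100) (49/100)))
       \<and> (\<not> chen_conditions (7/10) 2 (-4) (1/10) (1/10) \<and>
          extreme_function (7/10) (chen_function (7/10) 2 (-4) (1/10) (1/10)))"
proof -
  let ?\<pi> = "chen_function (7/10) 2 (-4) (1/100) (49/100)"
  \<comment> \<open>The second parameter set violates the lower bound on \<lambda>2: f - 1/s+ = 1/5
    exceeds 1/10.\<close>
  have H1: "chen_conditions (7/10) 2 (-4) (1/100) (49/100)"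
    and H2: "\<not> chen_conditions (7/10) 2 (-4) (1/10) (1/10)"
    by (simp_all add: chen_conditions_def)
  have not_sub: "\<not> ?\<pi> (1853/2000 + 7/2000) \<le> ?\<pi> (1853/2000) + ?\<pi> (7/2000)"
    by (simp add: chen_not_subadditive_values)
  have per: "?\<pi> (7/10 - (1853/2000 + 7/2000)) = ?\<pi> (77/100)"
    by (rule chen_function_cong_Ints) simp
  \<comment> \<open>Symmetry at the single point 93/100 suffices: validity would force the
    subadditivity that fails there.\<close>
  have "?\<pi> (1853/2000 + 7/2000) + ?\<pi> (7/10 - (1853/2000 + 7/2000)) = 1"
    unfolding per by (simp add: chen_not_subadditive_values)
  then have "\<not> valid_function (7/10) ?\<pi>"
    using valid_symmetric_subadditive not_sub by blast
  then have "\<not> extreme_function (7/10) ?\<pi>"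
    by (simp add: extreme_function_def)
  moreover have "\<not> subadditive_function ?\<pi>"
    using not_sub unfolding subadditive_function_def by blast
  moreover have "\<not> (\<forall>f sp sm l1 l2 :: real. 0 < f \<and> f < 1 \<and> sp > 0 \<and> sm < 0 \<longrightarrow>
      chen_conditions f sp sm l1 l2 \<longrightarrow> extreme_function f (chen_function f sp sm l1 l2))"
    using H1 calculation(1) by (intro notI) (auto dest!: spec[of _ "7/10"] spec[of _ 2] spec[of _ "-4"])
  moreover have "\<not> (\<forall>f sp sm l1 l2 :: real. 0 < f \<and> f < 1 \<and> sp > 0 \<and> sm < 0 \<longrightarrow>
      extreme_function f (chen_function f sp sm l1 l2) \<longrightarrow> chen_conditions f sp sm l1 l2)"
    using H2 chen_ex_extreme
    by (intro notI) (auto dest!: spec[of _ "7/10"] spec[of _ 2] spec[of _ "-4"])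
  ultimately show ?thesis
    using H1 H2 chen_ex_extreme by blast
qed

end
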